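(* Let $(\theta,\varphi)$ be a continuous time random dynamical system (RDS) over a probability space $(\Omega,\mathcal F,\mathbb P)$ on a nonempty finite state space $X$ (equipped with the discrete topology), and assume that it synchronizes almost surely. Then $$\sup\{\|P^t_\mu-P^t_\nu\|_{TV} : \mu,\nu\text{ are probability distributions on }X\}\longrightarrow 0\quad\text{as }t\to\infty.$$ If in addition a stationary measure $\pi$ exists for the RDS, then $\pi$ is a global attractor with uniform convergence: $$\sup\{\|P^t_\mu-\pi\|_{TV} : \mu\text{ is a probability distribution on }X\}\longrightarrow 0\quad\text{as }t\to\infty.$$ For both results the convergence has an exponential rate (i.e. the supremum is bounded by $Ce^{-ct}$ for all $t\ge 0$ with some constants $C,c>0$) if the RDS is stochastically independent in the following sense: the solutions $\varphi(t,x,\cdot)$ are stochastically independent on non-overlapping intervals, i.e., $\varphi(t,x,\cdot)$ for $t\in[t_1,t_2)$ is independent of $\varphi(s,x,\cdot)$ for $s\in[s_1,s_2)$ if $[t_1,t_2)\cap[s_1,s_2)=\emptyset$.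
   Context: RDS: A continuous time random dynamical system $(\theta,\varphi)$ on a topological space $X$ (with its Borel $\sigma$-algebra) consists of (I) a family $\theta=\{\theta_t\}_{t\in\mathbb R}$ of maps on a probability space $(\Omega,\mathcal F,\mathbb P)$ with $\theta_0(\omega)=\omega$, $\theta_{s+t}(\omega)=\theta_s\circ\theta_t(\omega)$ for all $\omega\in\Omega$ and $s,t\in\mathbb R$, $(t,\omega)\mapsto\theta_t(\omega)$ measurable, and $\mathbb P(\theta_tB)=\mathbb P(B)$ for all $B\in\mathcal F$, $t\in\mathbb R$; (II) a map $\varphi:\mathbb R_0^+\times X\times\Omega\to X$ (where $\mathbb R_0^+=[0,\infty)$) such that $\varphi(0,x,\omega)=x$ for all $x,\omega$; $\varphi(s+t,x,\omega)=\varphi(s,\varphi(t,x,\omega),\theta_t\omega)$ for all $s,t\ge 0$, $x\in X$, $\omega\in\Omega$; $(t,x,\omega)\mapsto\varphi(t,x,\omega)$ is measurable; and $x\mapsto\varphi(t,x,\omega)$ is continuous for all $(t,\omega)$. For $B\subseteq X$ write $\varphi(t,B,\omega)=\{\varphi(t,x,\omega): x\in B\}$. Almost sure synchronization: let $\Gamma(t,t_0):=\{\omega\in\Omega:\varphi(t,x_1,\theta_{t_0}\omega)=\varphi(t,x_2,\theta_{t_0}\omega)\text{ for all }x_1,x_2\in X\}$. The RDS synchronizes almost surely if one (and hence all) of the following equivalent statements holds: (2) for any $t_0\in\mathbb R$, $\lim_{t\to\infty}\mathbb P(\Gamma(t,t_0))=1$ and $\lim_{t\to\infty}\mathbb P(\Gamma(t,t_0-t))=1$,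 with rate of convergence independent of $t_0$ (i.e. uniformly in $t_0$); (3) for any $t_0\in\mathbb R$, $\mathbb P(\{\omega:\varphi(t,X,\theta_{t_0}\omega)\text{ is a singleton for some }t\ge 0\})=1$; (4) for any $t_0\in\mathbb R$, $\mathbb P(\{\omega:\varphi(t,X,\theta_{t_0-t}\omega)\text{ is a singleton for some }t\ge 0\})=1$; (5) the sets $A(\omega):=\bigcap_{t\ge 0}\varphi(t,X,\theta_{-t}\omega)$ are singletons for almost all $\omega\in\Omega$. Evolution of distributions: for $x\in X$ and $t\ge 0$, $P^t_x$ is the probability distribution on $X$ given by $P^t_x(\{z\})=\mathbb P(\{\omega\in\Omega:\varphi(t,x,\omega)=z\})$; for a probability distribution $\mu$ on $X$, $P^t_\mu:=\sum_{x\in X}\mu(\{x\})P^t_x$. A stationary distribution (stationary measure) of the RDS is a probability distribution $\pi$ on $X$ with $\pi=P^t_\pi$ for all $t\ge 0$. The total variation distance is $\|\mu-\nu\|_{TV}=\max_{B\subseteq X}|\mu(B)-\nu(B)|$. *)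

theory Defs
  imports "HOL-Probability.Probability"
begin

text \<open>Only the values \<open>\<phi> t x \<omega>\<close> with \<open>t \<ge> 0\<close> and \<open>\<omega> \<in> space M\<close> are meaningful.\<close>

locale random_dynamical_system = prob_space M
  for M :: "'w measure"
  and \<theta> :: "real \<Rightarrow> 'w \<Rightarrow> 'w"
  and \<phi> :: "real \<Rightarrow> 'x::topological_space \<Rightarrow> 'w \<Rightarrow> 'x" +
  assumes theta_0: "\<omega> \<in> space M \<Longrightarrow> \<theta> 0 \<omega> = \<omega>"
    and theta_add: "\<omega> \<in> space M \<Longrightarrow> \<theta> (s + t) \<omega> = \<theta> s (\<theta> t \<omega>)"
    and theta_measurable: "(\<lambda>(t, \<omega>). \<theta> t \<omega>) \<in> borel \<Otimes>\<^sub>M M \<rightarrow>\<^sub>M M"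
    and theta_invariant: "B \<in> sets M \<Longrightarrow> prob (\<theta> t ` B) = prob B"
    and phi_0: "\<omega> \<in> space M \<Longrightarrow> \<phi> 0 x \<omega> = x"
    and phi_cocycle: "0 \<le> s \<Longrightarrow> 0 \<le> t \<Longrightarrow> \<omega> \<in> space M \<Longrightarrow>
      \<phi> (s + t) x \<omega> = \<phi> s (\<phi> t x \<omega>) (\<theta> t \<omega>)"
    and phi_measurable:
      "(\<lambda>(t, x, \<omega>). \<phi> t x \<omega>) \<in> restrict_space borel {0..} \<Otimes>\<^sub>M (borel \<Otimes>\<^sub>M M) \<rightarrow>\<^sub>M borel"
    and phi_continuous: "0 \<le> t \<Longrightarrow> \<omega> \<in> space M \<Longrightarrow> continuous_on UNIV (\<lambda>x. \<phi> t x \<omega>)"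

definition sync_event ::
    "'w measure \<Rightarrow> (real \<Rightarrow> 'w \<Rightarrow> 'w) \<Rightarrow> (real \<Rightarrow> 'x \<Rightarrow> 'w \<Rightarrow> 'x) \<Rightarrow> real \<Rightarrow> real \<Rightarrow> 'w set" where
  "sync_event M \<theta> \<phi> t t0 = {\<omega> \<in> space M. \<forall>x1 x2. \<phi> t x1 (\<theta> t0 \<omega>) = \<phi> t x2 (\<theta> t0 \<omega>)}"

definition sync_in_probability ::
    "'w measure \<Rightarrow> (real \<Rightarrow> 'w \<Rightarrow> 'w) \<Rightarrow> (real \<Rightarrow> 'x \<Rightarrow> 'w \<Rightarrow> 'x) \<Rightarrow> bool" where
  "sync_in_probability M \<theta> \<phi> \<longleftrightarrow>
     uniform_limit UNIV (\<lambda>t t0. measure M (sync_event M \<theta> \<phi> t t0)) (\<lambda>t0. 1) at_top \<and>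
     uniform_limit UNIV (\<lambda>t t0. measure M (sync_event M \<theta> \<phi> t (t0 - t))) (\<lambda>t0. 1) at_top"

definition sync_forward ::
    "'w measure \<Rightarrow> (real \<Rightarrow> 'w \<Rightarrow> 'w) \<Rightarrow> (real \<Rightarrow> 'x \<Rightarrow> 'w \<Rightarrow> 'x) \<Rightarrow> bool" where
  "sync_forward M \<theta> \<phi> \<longleftrightarrow>
     (\<forall>t0. measure M {\<omega> \<in> space M. \<exists>t\<ge>0. is_singleton (range (\<lambda>x. \<phi> t x (\<theta> t0 \<omega>)))} = 1)"

definition sync_pullback ::
    "'w measure \<Rightarrow> (real \<Rightarrow> 'w \<Rightarrow> 'w) \<Rightarrow> (real \<Rightarrow> 'x \<Rightarrow> 'w \<Rightarrow> 'x) \<Rightarrow> bool" where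
  "sync_pullback M \<theta> \<phi> \<longleftrightarrow>
     (\<forall>t0. measure M {\<omega> \<in> space M. \<exists>t\<ge>0. is_singleton (range (\<lambda>x. \<phi> t x (\<theta> (t0 - t) \<omega>)))} = 1)"

definition random_attractor ::
    "(real \<Rightarrow> 'w \<Rightarrow> 'w) \<Rightarrow> (real \<Rightarrow> 'x \<Rightarrow> 'w \<Rightarrow> 'x) \<Rightarrow> 'w \<Rightarrow> 'x set" where
  "random_attractor \<theta> \<phi> \<omega> = (\<Inter>t\<in>{0..}. range (\<lambda>x. \<phi> t x (\<theta> (- t) \<omega>)))"

definition sync_attractor ::
    "'w measure \<Rightarrow> (real \<Rightarrow> 'w \<Rightarrow> 'w) \<Rightarrow> (real \<Rightarrow> 'x \<Rightarrow> 'w \<Rightarrow> 'x) \<Rightarrow> bool" where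
  "sync_attractor M \<theta> \<phi> \<longleftrightarrow> (AE \<omega> in M. is_singleton (random_attractor \<theta> \<phi> \<omega>))"

text \<open>The four conditions are equivalent for an RDS on a finite discrete space; synchronization
  means that one of them holds.\<close>

definition synchronizes_almost_surely ::
    "'w measure \<Rightarrow> (real \<Rightarrow> 'w \<Rightarrow> 'w) \<Rightarrow> (real \<Rightarrow> 'x \<Rightarrow> 'w \<Rightarrow> 'x) \<Rightarrow> bool" where
  "synchronizes_almost_surely M \<theta> \<phi> \<longleftrightarrow>
     sync_in_probability M \<theta> \<phi> \<or> sync_forward M \<theta> \<phi> \<or> sync_pullback M \<theta> \<phi> \<or> sync_attractor M \<theta> \<phi>"

definition transition_distribution ::
    "'w measure \<Rightarrow> (real \<Rightarrow> 'x \<Rightarrow> 'w \<Rightarrow> 'x) \<Rightarrow> real \<Rightarrow> 'x::finite \<Rightarrow> 'x pmf" where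
  "transition_distribution M \<phi> t x = embed_pmf (\<lambda>z. measure M {\<omega> \<in> space M. \<phi> t x \<omega> = z})"

definition evolved_distribution ::
    "'w measure \<Rightarrow> (real \<Rightarrow> 'x \<Rightarrow> 'w \<Rightarrow> 'x) \<Rightarrow> real \<Rightarrow> 'x::finite pmf \<Rightarrow> 'x pmf" where
  "evolved_distribution M \<phi> t \<mu> =
     embed_pmf (\<lambda>z. \<Sum>x\<in>UNIV. pmf \<mu> x * pmf (transition_distribution M \<phi> t x) z)"

text \<open>Since \<^const>\<open>embed_pmf\<close> is unspecified unless the masses are nonnegative and sum to one,
  we check that both definitions have the intended point masses.\<close>

lemma pmf_embed_finite:
  fixes f :: "'x::finite \<Rightarrow> real"
  assumes "\<And>z. 0 \<le> f z" "(\<Sum>z\<in>UNIV. f z) = 1"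
  shows "pmf (embed_pmf f) z = f z"
proof (rule pmf_embed_pmf)
  show "(\<integral>\<^sup>+x. ennreal (f x) \<partial>count_space UNIV) = 1"
    using assms by (simp add: nn_integral_count_space_finite)
qed (use assms in auto)

lemma pmf_transition_distribution:
  fixes \<phi> :: "real \<Rightarrow> 'x::{finite, discrete_topology} \<Rightarrow> 'w \<Rightarrow> 'x"
  assumes "random_dynamical_system M \<theta> \<phi>" and t: "0 \<le> t"
  shows "pmf (transition_distribution M \<phi> t x) z = measure M {\<omega> \<in> space M. \<phi> t x \<omega> = z}"
  unfolding transition_distribution_def
proof (rule pmf_embed_finite)
  interpret R: random_dynamical_system M \<theta> \<phi> by fact
  have "(\<lambda>\<omega>. (t, x, \<omega>)) \<in> M \<rightarrow>\<^sub>M restrict_space borel {0..} \<Otimes>\<^sub>M (borel \<Otimes>\<^sub>M M)"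
    using t by (intro measurable_Pair measurable_const measurable_ident)
      (auto simp: space_restrict_space)
  from measurable_compose[OF this R.phi_measurable]
  have meas: "\<phi> t x \<in> M \<rightarrow>\<^sub>M borel" by simp
  have S: "{\<omega> \<in> space M. \<phi> t x \<omega> = z} \<in> sets M" for z
    using measurable_sets[OF meas borel_open[OF Topological_Spaces.open_discrete[of "{z}"]]]
    by (simp add: vimage_def Int_def conj_commute)
  have "(\<Sum>z\<in>UNIV. measure M {\<omega> \<in> space M. \<phi> t x \<omega> = z}) = measure M (\<Union>z. {\<omega> \<in> space M. \<phi> t x \<omega> = z})"
    using S by (intro R.finite_measure_finite_Union[symmetric]) (auto simp: disjoint_family_on_def)
  also have "(\<Union>z. {\<omega> \<in> space M. \<phi> t x \<omega> = z}) = space M" by auto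
  finally show "(\<Sum>z\<in>UNIV. measure M {\<omega> \<in> space M. \<phi> t x \<omega> = z}) = 1" by (simp add: R.prob_space)
qed simp

lemma pmf_evolved_distribution:
  fixes \<mu> :: "'x::finite pmf"
  shows "pmf (evolved_distribution M \<phi> t \<mu>) z =
    (\<Sum>x\<in>UNIV. pmf \<mu> x * pmf (transition_distribution M \<phi> t x) z)"
  unfolding evolved_distribution_def
proof (rule pmf_embed_finite)
  have "(\<Sum>z\<in>UNIV. \<Sum>x\<in>UNIV. pmf \<mu> x * pmf (transition_distribution M \<phi> t x) z)
      = (\<Sum>x\<in>UNIV. pmf \<mu> x * (\<Sum>z\<in>UNIV. pmf (transition_distribution M \<phi> t x) z))"
    by (subst sum.swap) (simp add: sum_distrib_left)
  then show "(\<Sum>z\<in>UNIV. \<Sum>x\<in>UNIV. pmf \<mu> x * pmf (transition_distribution M \<phi> t x) z) = 1"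
    by (simp add: sum_pmf_eq_1)
qed (simp add: sum_nonneg)

definition stationary_distribution ::
    "'w measure \<Rightarrow> (real \<Rightarrow> 'x \<Rightarrow> 'w \<Rightarrow> 'x) \<Rightarrow> 'x::finite pmf \<Rightarrow> bool" where
  "stationary_distribution M \<phi> \<pi> \<longleftrightarrow> (\<forall>t\<ge>0. \<pi> = evolved_distribution M \<phi> t \<pi>)"

definition tv_dist :: "'x::finite pmf \<Rightarrow> 'x pmf \<Rightarrow> real" where
  "tv_dist \<mu> \<nu> = (MAX B\<in>UNIV. \<bar>measure_pmf.prob \<mu> B - measure_pmf.prob \<nu> B\<bar>)"

text \<open>The events determined by the solution on \<open>[t1, t2)\<close> that is in state \<open>x\<close> at time \<open>t1\<close>: at time
  \<open>t\<close> this solution has the value \<open>\<phi> (t - t1) x (\<theta> t1 \<omega>)\<close>.\<close>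

definition solution_events ::
    "'w measure \<Rightarrow> (real \<Rightarrow> 'w \<Rightarrow> 'w) \<Rightarrow> (real \<Rightarrow> 'x::topological_space \<Rightarrow> 'w \<Rightarrow> 'x) \<Rightarrow>
     real \<Rightarrow> real \<Rightarrow> 'x \<Rightarrow> 'w set set" where
  "solution_events M \<theta> \<phi> t1 t2 x = sigma_sets (space M)
     {(\<lambda>\<omega>. \<phi> (t - t1) x (\<theta> t1 \<omega>)) -` B \<inter> space M | t B. t \<in> {t1..<t2} \<and> B \<in> sets borel}"

text \<open>Solutions have to be restarted at the left end of each interval. The values at different times
  of a single trajectory started at time 0 are not independent for a Markov process; since \<open>\<phi>\<close> is
  jointly measurable, requiring this would make \<open>\<phi> t x\<close> almost surely constant for each \<open>t\<close>. The
  states \<open>x\<close> and \<open>y\<close> in which the two solutions start are arbitrary.\<close>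

definition stochastically_independent ::
    "'w measure \<Rightarrow> (real \<Rightarrow> 'w \<Rightarrow> 'w) \<Rightarrow> (real \<Rightarrow> 'x::topological_space \<Rightarrow> 'w \<Rightarrow> 'x) \<Rightarrow> bool" where
  "stochastically_independent M \<theta> \<phi> \<longleftrightarrow>
     (\<forall>x y t1 t2 s1 s2. 0 \<le> t1 \<and> 0 \<le> s1 \<and> {t1..<t2} \<inter> {s1..<s2} = {} \<longrightarrow>
        prob_space.indep_set M (solution_events M \<theta> \<phi> t1 t2 x) (solution_events M \<theta> \<phi> s1 s2 y))"

end

theory Submission
  imports Defs
begin

text \<open>
  Two trajectories with the same noise differ at time \<open>t\<close> only off the coalescence event \<open>\<Gamma> t 0\<close>, so
  \<open>osc t\<close>, the largest total variation distance of two rows of the transition matrix \<open>P\<^sup>t\<close>, is at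
  most \<open>1 - prob (\<Gamma> t 0)\<close>. By each of the four notions of synchronization this bound tends to 0:
  coalescence events increase in \<open>t\<close>, and the pullback versions have the same probability since
  \<open>\<theta>\<close> preserves the measure. A stationary distribution equals its own evolution.

  For the rate one wants \<open>osc (t + s) \<le> osc t * osc s\<close>. As the intervals in the independence
  assumption are half-open, independence only relates the state at time \<open>t\<close> to the system restarted
  at \<open>t + \<delta>\<close> with \<open>\<delta> > 0\<close>, and one loses the probability of a jump between these times. Translation
  continuity in \<open>L\<^sup>1\<close> and Fubini's theorem give, in every interval of length 1, a time \<open>t\<close> at
  which this loss is arbitrarily small for suitable \<open>\<delta> \<le> 1\<close>. If \<open>osc \<le> 1/2\<close> after time \<open>T\<close>, the
  supremum of \<open>osc\<close> over \<open>[s, \<infinity>)\<close> therefore halves whenever \<open>s\<close> grows by \<open>T + 2\<close>.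
\<close>

section \<open>Translation continuity of Lebesgue measure\<close>

lemma compact_translate_subset_open:
  fixes K U :: "real set"
  assumes "compact K" "open U" "K \<subseteq> U"
  obtains e where "e > 0" "\<And>s t. t \<in> K \<Longrightarrow> \<bar>s\<bar> < e \<Longrightarrow> t + s \<in> U"
proof -
  have "K \<inter> - U = {}" using assms by auto
  with assms obtain e where e: "e > 0" "\<forall>x\<in>K. \<forall>y\<in>- U. e \<le> dist x y"
    using separate_compact_closed[of K "- U"] by auto
  show ?thesis
  proof (rule that[OF e(1)])
    fix s t :: real assume "t \<in> K" "\<bar>s\<bar> < e"
    then show "t + s \<in> U" using e(2) by (force simp: dist_real_def)
  qed
qed

lemma emeasure_lborel_translate:
  assumes "V \<in> sets borel"
  shows "emeasure lborel {t::real. t + s \<in> V} = emeasure lborel V"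
proof -
  have "emeasure lborel V = emeasure (distr lborel borel ((+) s)) V"
    by (simp add: lborel_distr_plus)
  also have "\<dots> = emeasure lborel {t. t + s \<in> V}"
    using assms by (subst emeasure_distr) (auto simp: vimage_def add.commute)
  finally show ?thesis ..
qed

text \<open>Regularity reduces this to a compact \<open>K\<close> inside \<open>A\<close> and an
  open \<open>U\<close> around \<open>K\<close>, where \<open>A - K\<close> and \<open>U - K\<close>
  both have measure below \<open>e\<close>. For a small shift, a point \<open>t\<close> of
  \<open>K\<close> moves into \<open>U\<close>, and if it lands outside \<open>A\<close> it lands in
  \<open>U - K\<close>. Hence every bad \<open>t\<close> lies in \<open>A - K\<close> or in a
  translate of \<open>U - K\<close>.\<close>

lemma translation_continuous_emeasure:
  fixes A :: "real set"
  assumes A: "A \<in> sets borel" "bounded A"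
  shows "(\<lambda>n. emeasure lborel {t \<in> A. t + 1 / real (Suc n) \<notin> A}) \<longlonglongrightarrow> 0"
proof (rule order_tendstoI)
  fix a :: ennreal assume "a > 0"
  then obtain e where e: "0 < e" "ennreal (2 * e) \<le> a"
  proof (cases a)
    case (real r)
    with \<open>a > 0\<close> show ?thesis by (intro that[of "r / 2"]) auto
  qed (auto intro: that[of 1])
  have AL: "A \<in> sets lebesgue" using A(1) by simp
  obtain K where K: "closed K" "K \<subseteq> A" "A - K \<in> lmeasurable" "emeasure lebesgue (A - K) < ennreal e"
    using sets_lebesgue_inner_closed[OF AL e(1)] by metis
  have "bounded K" using K(2) A(2) bounded_subset by blast
  with K have cK: "compact K" by (simp add: compact_eq_bounded_closed)
  have "K \<in> sets lebesgue" using K(1) by simp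
  from sets_lebesgue_outer_open[OF this e(1)]
  obtain U where U: "open U" "K \<subseteq> U" "U - K \<in> lmeasurable" "emeasure lebesgue (U - K) < ennreal e"
    by metis
  obtain d where d: "d > 0" "\<And>s t. t \<in> K \<Longrightarrow> \<bar>s\<bar> < d \<Longrightarrow> t + s \<in> U"
    using compact_translate_subset_open[OF cK U(1,2)] by metis
  have KB: "K \<in> sets borel" "U \<in> sets borel" using K U by auto
  have "(\<lambda>n. 1 / real (Suc n)) \<longlonglongrightarrow> 0"
    using LIMSEQ_inverse_real_of_nat by (simp add: inverse_eq_divide)
  then have "\<forall>\<^sub>F n in sequentially. 1 / real (Suc n) < d"
    using d(1) order_tendstoD(2) by blast
  then show "\<forall>\<^sub>F n in sequentially. emeasure lborel {t \<in> A. t + 1 / real (Suc n) \<notin> A} < a"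
  proof eventually_elim
    case (elim n)
    let ?s = "1 / real (Suc n)"
    have "{t \<in> A. t + ?s \<notin> A} \<subseteq> (A - K) \<union> {t. t + ?s \<in> U - K}"
      using d(2)[of _ ?s] elim K(2) by auto
    moreover have m: "{t. t + ?s \<in> U - K} \<in> sets borel"
    proof -
      have "(\<lambda>t. t + ?s) -` (U - K) \<inter> space borel \<in> sets borel"
        using KB by (intro measurable_sets[where A = borel]) auto
      then show ?thesis by (simp add: vimage_def)
    qed
    ultimately have "emeasure lborel {t \<in> A. t + ?s \<notin> A}
        \<le> emeasure lborel ((A - K) \<union> {t. t + ?s \<in> U - K})"
      using KB A by (intro emeasure_mono) auto
    also have "\<dots> \<le> emeasure lborel (A - K) + emeasure lborel {t. t + ?s \<in> U - K}"
      using KB A m by (intro emeasure_subadditive) auto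
    also have "\<dots> = emeasure lborel (A - K) + emeasure lborel (U - K)"
      using KB by (subst emeasure_lborel_translate) auto
    also have "\<dots> < ennreal e + ennreal e"
      using K(4) U(4) KB A by (intro add_strict_mono) auto
    also have "\<dots> = ennreal (2 * e)" using e by (simp flip: ennreal_plus)
    finally show ?case using e(2) by simp
  qed
qed auto

section \<open>Random dynamical systems on finite discrete spaces\<close>

lemma sets_borel_discrete: "(B :: 'x::discrete_topology set) \<in> sets borel"
  by (rule borel_open[OF Topological_Spaces.open_discrete])

locale discrete_rds = random_dynamical_system M \<theta> \<phi>
  for M :: "'w measure" and \<theta>
    and \<phi> :: "real \<Rightarrow> 'x::{finite, discrete_topology} \<Rightarrow> 'w \<Rightarrow> 'x"
begin

lemma measurable_theta [measurable]: "\<theta> t \<in> M \<rightarrow>\<^sub>M M"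
  using measurable_compose[OF measurable_Pair1' theta_measurable] by simp

lemma theta_in_space: "\<omega> \<in> space M \<Longrightarrow> \<theta> t \<omega> \<in> space M"
  by (meson measurable_space measurable_theta)

lemma theta_inverse: "\<omega> \<in> space M \<Longrightarrow> \<theta> (- t) (\<theta> t \<omega>) = \<omega>"
  using theta_add[of \<omega> "- t" t] theta_0 by simp

lemma theta_inverse': "\<omega> \<in> space M \<Longrightarrow> \<theta> t (\<theta> (- t) \<omega>) = \<omega>"
  using theta_inverse[of \<omega> "- t"] by simp

text \<open>Invariance is assumed for images. Since \<open>\<theta> (- t)\<close> inverts
  \<open>\<theta> t\<close>, the preimage under one is the image under the other.\<close>

lemma prob_theta_vimage:
  assumes "B \<in> sets M"
  shows "prob {\<omega> \<in> space M. \<theta> t \<omega> \<in> B} = prob B"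
proof -
  have "{\<omega> \<in> space M. \<theta> t \<omega> \<in> B} = \<theta> (- t) ` B"
  proof (intro set_eqI iffI)
    fix \<omega> assume "\<omega> \<in> {\<omega> \<in> space M. \<theta> t \<omega> \<in> B}"
    then show "\<omega> \<in> \<theta> (- t) ` B" using theta_inverse[of \<omega> t] by (metis (mono_tags, lifting) imageI mem_Collect_eq)
  next
    fix \<omega> assume "\<omega> \<in> \<theta> (- t) ` B"
    then obtain \<omega>' where "\<omega>' \<in> B" "\<omega> = \<theta> (- t) \<omega>'" by auto
    moreover have "\<omega>' \<in> space M" using \<open>\<omega>' \<in> B\<close> assms sets.sets_into_space by auto
    ultimately show "\<omega> \<in> {\<omega> \<in> space M. \<theta> t \<omega> \<in> B}"
      using theta_inverse'[of \<omega>' t] theta_in_space[of \<omega>' "- t"] by auto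
  qed
  then show ?thesis using theta_invariant[OF assms] by simp
qed

text \<open>Truncating at 0 extends the flow to all real times, so that products with Lebesgue
  measure on the whole line can be used below.\<close>

lemma measurable_phi_pair:
  "(\<lambda>(t, \<omega>). \<phi> (max 0 t) x \<omega>) \<in> borel \<Otimes>\<^sub>M M \<rightarrow>\<^sub>M borel"
proof -
  have "(\<lambda>(t :: real, \<omega>). (max 0 t, x, \<omega>)) \<in> borel \<Otimes>\<^sub>M M \<rightarrow>\<^sub>M restrict_space borel {0..} \<Otimes>\<^sub>M (borel \<Otimes>\<^sub>M M)"
    unfolding case_prod_beta
    by (intro measurable_Pair measurable_restrict_space2 measurable_const measurable_snd
        borel_measurable_max measurable_fst) (auto simp: le_max_iff_disj)
  from measurable_compose[OF this phi_measurable] show ?thesis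
    by (simp add: case_prod_beta)
qed

lemma measurable_phi: "0 \<le> t \<Longrightarrow> \<phi> t x \<in> M \<rightarrow>\<^sub>M borel"
  using measurable_compose[OF measurable_Pair1'[of t borel M] measurable_phi_pair[of x]] by simp

lemma event_phi: "0 \<le> t \<Longrightarrow> {\<omega> \<in> space M. \<phi> t x \<omega> \<in> B} \<in> sets M"
  using measurable_sets[OF measurable_phi sets_borel_discrete[of B], of t x]
  by (simp add: vimage_def Int_def conj_commute)

lemma event_phi_theta: "0 \<le> t \<Longrightarrow> {\<omega> \<in> space M. \<phi> t x (\<theta> r \<omega>) \<in> B} \<in> sets M"
  using measurable_sets[OF measurable_compose[OF measurable_theta measurable_phi] sets_borel_discrete]
  by (simp add: vimage_def Int_def conj_commute)

section \<open>Transition probabilities and their oscillation\<close>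

definition p :: "real \<Rightarrow> 'x \<Rightarrow> 'x set \<Rightarrow> real" where
  "p t x B = prob {\<omega> \<in> space M. \<phi> t x \<omega> \<in> B}"

lemma prob_phi_theta:
  assumes "0 \<le> t"
  shows "prob {\<omega> \<in> space M. \<phi> t x (\<theta> r \<omega>) \<in> B} = p t x B"
proof -
  have "{\<omega> \<in> space M. \<phi> t x (\<theta> r \<omega>) \<in> B} = {\<omega> \<in> space M. \<theta> r \<omega> \<in> {\<omega> \<in> space M. \<phi> t x \<omega> \<in> B}}"
    using theta_in_space by auto
  then show ?thesis
    unfolding p_def by (simp only: prob_theta_vimage[OF event_phi[OF assms]])
qed

lemma p_eq_sum_singletons:
  assumes "0 \<le> t"
  shows "p t x B = (\<Sum>y\<in>B. p t x {y})"
proof -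
  have "{\<omega> \<in> space M. \<phi> t x \<omega> \<in> B} = (\<Union>y\<in>B. {\<omega> \<in> space M. \<phi> t x \<omega> \<in> {y}})" by auto
  then show ?thesis unfolding p_def
    by (simp only:, intro finite_measure_finite_Union)
       (auto simp: disjoint_family_on_def event_phi[OF assms, of x "{_}", simplified])
qed

lemma p_UNIV: "p t x UNIV = 1"
  by (simp add: p_def prob_space)

text \<open>This is the Dobrushin coefficient of the transition matrix. Signed differences already
  give total variation, since \<open>x\<close> and \<open>y\<close> may be exchanged.\<close>

definition osc :: "real \<Rightarrow> real" where
  "osc t = (MAX (x, y, B)\<in>UNIV. p t x B - p t y B)"

lemma osc_ge: "p t x B - p t y B \<le> osc t"
  unfolding osc_def by (intro Max_ge) (auto intro!: image_eqI[of _ _ "(x, y, B)"])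

lemma osc_le: "(\<And>x y B. p t x B - p t y B \<le> r) \<Longrightarrow> osc t \<le> r"
  unfolding osc_def by (subst Max_le_iff) auto

lemma osc_nonneg: "0 \<le> osc t"
  using osc_ge[of t _ UNIV] by (metis diff_self)

lemma prob_evolved_distribution:
  assumes "0 \<le> t"
  shows "measure_pmf.prob (evolved_distribution M \<phi> t \<mu>) B = (\<Sum>x\<in>UNIV. pmf \<mu> x * p t x B)"
proof -
  have rds: "random_dynamical_system M \<theta> \<phi>" by unfold_locales
  have "measure_pmf.prob (evolved_distribution M \<phi> t \<mu>) B
      = (\<Sum>z\<in>B. \<Sum>x\<in>UNIV. pmf \<mu> x * p t x {z})"
    by (simp add: measure_measure_pmf_finite pmf_evolved_distribution
        pmf_transition_distribution[OF rds assms] p_def)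
  also have "\<dots> = (\<Sum>x\<in>UNIV. pmf \<mu> x * p t x B)"
    by (subst sum.swap) (simp add: p_eq_sum_singletons[OF assms, of _ B] sum_distrib_left)
  finally show ?thesis .
qed

text \<open>Weighting pairs of initial states by the product of \<mu> and \<nu> turns the difference
  of the two evolved masses into an average of differences of rows, each at most
  \<open>osc t\<close>.\<close>

lemma tv_dist_evolved_le_osc:
  assumes "0 \<le> t"
  shows "tv_dist (evolved_distribution M \<phi> t \<mu>) (evolved_distribution M \<phi> t \<nu>) \<le> osc t"
proof -
  have le: "measure_pmf.prob (evolved_distribution M \<phi> t \<mu>) B
      - measure_pmf.prob (evolved_distribution M \<phi> t \<nu>) B \<le> osc t" for \<mu> \<nu> B
  proof -
    have s: "(\<Sum>x\<in>UNIV. pmf \<mu> x) = 1" for \<mu> :: "'x pmf" by (simp add: sum_pmf_eq_1)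
    have "(\<Sum>x\<in>UNIV. pmf \<mu> x * p t x B) = (\<Sum>x\<in>UNIV. \<Sum>y\<in>UNIV. pmf \<mu> x * pmf \<nu> y * p t x B)"
      by (simp add: s flip: sum_distrib_left sum_distrib_right)
    moreover have "(\<Sum>y\<in>UNIV. pmf \<nu> y * p t y B) = (\<Sum>x\<in>UNIV. \<Sum>y\<in>UNIV. pmf \<mu> x * pmf \<nu> y * p t y B)"
      by (simp add: s mult.assoc flip: sum_distrib_left sum_distrib_right)
    ultimately have "(\<Sum>x\<in>UNIV. pmf \<mu> x * p t x B) - (\<Sum>y\<in>UNIV. pmf \<nu> y * p t y B)
        = (\<Sum>x\<in>UNIV. \<Sum>y\<in>UNIV. pmf \<mu> x * pmf \<nu> y * (p t x B - p t y B))"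
      by (simp add: sum_subtractf right_diff_distrib)
    also have "\<dots> \<le> (\<Sum>x\<in>UNIV. \<Sum>y\<in>UNIV. pmf \<mu> x * pmf \<nu> y * osc t)"
      by (intro sum_mono mult_left_mono osc_ge) auto
    also have "\<dots> = osc t"
      by (simp add: s flip: sum_distrib_left sum_distrib_right)
    finally show ?thesis by (simp add: prob_evolved_distribution[OF assms])
  qed
  show ?thesis
    unfolding tv_dist_def using le[of \<mu> _ \<nu>] le[of \<nu> _ \<mu>]
    by (subst Max_le_iff) (auto simp: abs_le_iff)
qed

end

lemma tv_dist_nonneg: "0 \<le> tv_dist \<mu> \<nu>"
  unfolding tv_dist_def by (subst Max_ge_iff) auto

context discrete_rds
begin

section \<open>Synchronization\<close>

abbreviation "\<Gamma> t t0 \<equiv> sync_event M \<theta> \<phi> t t0"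

lemma sets_sync_event:
  assumes "0 \<le> t"
  shows "\<Gamma> t t0 \<in> sets M"
proof -
  have "\<Gamma> t t0 = (\<Union>z. \<Inter>x. {\<omega> \<in> space M. \<phi> t x (\<theta> t0 \<omega>) \<in> {z}})"
    unfolding sync_event_def by auto
  also have "\<dots> \<in> sets M"
    by (intro sets.finite_UN sets.finite_INT event_phi_theta[OF assms]) auto
  finally show ?thesis .
qed

lemma prob_sync_event:
  assumes "0 \<le> t"
  shows "prob (\<Gamma> t t0) = prob (\<Gamma> t 0)"
proof -
  have "\<Gamma> t t0 = {\<omega> \<in> space M. \<theta> t0 \<omega> \<in> \<Gamma> t 0}"
    using theta_in_space by (auto simp: sync_event_def theta_0)
  then show ?thesis
    by (simp only: prob_theta_vimage[OF sets_sync_event[OF assms]])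
qed

lemma osc_le_sync:
  assumes "0 \<le> t"
  shows "osc t \<le> 1 - prob (\<Gamma> t 0)"
proof (rule osc_le)
  fix x y B
  have "{\<omega> \<in> space M. \<phi> t x \<omega> \<in> B} \<subseteq> {\<omega> \<in> space M. \<phi> t y \<omega> \<in> B} \<union> (space M - \<Gamma> t 0)"
    by (auto simp: sync_event_def theta_0) metis
  then have "p t x B \<le> prob ({\<omega> \<in> space M. \<phi> t y \<omega> \<in> B} \<union> (space M - \<Gamma> t 0))"
    unfolding p_def using event_phi[OF assms] sets_sync_event[OF assms]
    by (intro finite_measure_mono) auto
  also have "\<dots> \<le> p t y B + prob (space M - \<Gamma> t 0)"
    unfolding p_def using event_phi[OF assms] sets_sync_event[OF assms]
    by (intro measure_Un_le) auto
  also have "prob (space M - \<Gamma> t 0) = 1 - prob (\<Gamma> t 0)"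
    by (rule prob_compl[OF sets_sync_event[OF assms]])
  finally show "p t x B - p t y B \<le> 1 - prob (\<Gamma> t 0)" by simp
qed

lemma sync_event_iff_singleton:
  "\<omega> \<in> space M \<Longrightarrow> \<omega> \<in> \<Gamma> t t0 \<longleftrightarrow> is_singleton (range (\<lambda>x. \<phi> t x (\<theta> t0 \<omega>)))"
  unfolding sync_event_def is_singleton_iff_ex1 by (auto; blast)

lemma phi_split_theta:
  assumes "0 \<le> s" "0 \<le> t" "\<omega> \<in> space M"
  shows "\<phi> (s + t) x (\<theta> t0 \<omega>) = \<phi> s (\<phi> t x (\<theta> t0 \<omega>)) (\<theta> (t + t0) \<omega>)"
  using assms by (simp add: phi_cocycle theta_in_space theta_add)

text \<open>By the cocycle property, trajectories that have met stay together.\<close>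

lemma sync_event_forward_mono:
  assumes "0 \<le> t" "t \<le> u"
  shows "\<Gamma> t t0 \<subseteq> \<Gamma> u t0"
proof
  fix \<omega> assume "\<omega> \<in> \<Gamma> t t0"
  then have w: "\<omega> \<in> space M" "\<And>x1 x2. \<phi> t x1 (\<theta> t0 \<omega>) = \<phi> t x2 (\<theta> t0 \<omega>)"
    by (auto simp: sync_event_def)
  have "\<phi> u x (\<theta> t0 \<omega>) = \<phi> (u - t) (\<phi> t x (\<theta> t0 \<omega>)) (\<theta> (t + t0) \<omega>)" for x
    using phi_split_theta[of "u - t" t \<omega> x t0] assms w(1) by simp
  then show "\<omega> \<in> \<Gamma> u t0" using w by (auto simp: sync_event_def) metis
qed

text \<open>A solution started at the earlier time \<open>- u\<close> is in some state at time
  \<open>- t\<close>, so its value at time 0 is also reached from that state.\<close>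

lemma range_pullback_antimono:
  assumes "0 \<le> t" "t \<le> u" "\<omega> \<in> space M"
  shows "range (\<lambda>x. \<phi> u x (\<theta> (- u) \<omega>)) \<subseteq> range (\<lambda>x. \<phi> t x (\<theta> (- t) \<omega>))"
  using assms phi_split_theta[of t "u - t" \<omega> _ "- u"] by auto

lemma sync_event_pullback_mono:
  assumes "0 \<le> t" "t \<le> u"
  shows "\<Gamma> t (- t) \<subseteq> \<Gamma> u (- u)"
proof
  fix \<omega> assume w: "\<omega> \<in> \<Gamma> t (- t)"
  then have [simp]: "\<omega> \<in> space M" by (simp add: sync_event_def)
  from w range_pullback_antimono[OF assms, of \<omega>] show "\<omega> \<in> \<Gamma> u (- u)"
    by (auto simp: sync_event_def image_subset_iff) (metis (no_types, lifting) rangeE)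
qed

text \<open>Continuity from below along the integers, extended to real times by monotonicity.
  Passing to integers also replaces an uncountable union by a countable one.\<close>

lemma prob_increasing_tendsto_1:
  fixes A :: "real \<Rightarrow> 'w set"
  assumes A: "\<And>t. 0 \<le> t \<Longrightarrow> A t \<in> sets M"
    and mono: "\<And>t u. 0 \<le> t \<Longrightarrow> t \<le> u \<Longrightarrow> A t \<subseteq> A u"
    and ae: "AE \<omega> in M. \<exists>t\<ge>0. \<omega> \<in> A t"
  shows "((\<lambda>t. prob (A t)) \<longlongrightarrow> 1) at_top"
proof (rule order_tendstoI)
  fix a :: real assume a: "a < 1"
  have "(\<lambda>n. prob (A (real n))) \<longlonglongrightarrow> prob (\<Union>n. A (real n))"
    using A mono by (intro finite_Lim_measure_incseq) (auto simp: incseq_def)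
  moreover have "prob (\<Union>n. A (real n)) = 1"
  proof -
    have "AE \<omega> in M. \<omega> \<in> (\<Union>n. A (real n))"
      using ae
    proof eventually_elim
      case (elim \<omega>)
      then obtain t where t: "t \<ge> 0" "\<omega> \<in> A t" by auto
      obtain n where "t \<le> real n" using real_arch_simple by blast
      with t mono show ?case by blast
    qed
    then show ?thesis using A by (subst prob_eq_1) auto
  qed
  ultimately have "\<forall>\<^sub>F n in sequentially. a < prob (A (real n))"
    using a order_tendstoD(1) by fastforce
  then obtain N where N: "a < prob (A (real N))"
    unfolding eventually_sequentially by blast
  have "a < prob (A t)" if "t \<ge> real N" for t
    using N finite_measure_mono[OF mono[of "real N" t] A[of t]] that by simp
  then show "\<forall>\<^sub>F t in at_top. a < prob (A t)"
    unfolding eventually_at_top_linorder by blast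
next
  fix a :: real assume "1 < a"
  then show "\<forall>\<^sub>F t in at_top. prob (A t) < a"
    by (intro always_eventually) (use prob_le_1 order_le_less_trans in blast)
qed

text \<open>Each state other than the point of the attractor is missing from some pullback image. As
  there are finitely many states and the images decrease, the largest of these times excludes all of
  them at once.\<close>

lemma attractor_singleton_imp_sync:
  assumes "\<omega> \<in> space M" and sing: "is_singleton (random_attractor \<theta> \<phi> \<omega>)"
  shows "\<exists>t\<ge>0. \<omega> \<in> \<Gamma> t (- t)"
proof -
  define R where "R t = range (\<lambda>x. \<phi> t x (\<theta> (- t) \<omega>))" for t
  have anti: "R u \<subseteq> R t" if "0 \<le> t" "t \<le> u" for t u
    using range_pullback_antimono[OF that assms(1)] by (simp add: R_def)
  obtain a where a: "(\<Inter>t\<in>{0..}. R t) = {a}"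
    using sing by (auto simp: is_singleton_def random_attractor_def R_def)
  have "\<forall>z. \<exists>t\<ge>0. z \<noteq> a \<longrightarrow> z \<notin> R t" using a by auto
  then obtain \<tau> where \<tau>: "\<And>z. \<tau> z \<ge> 0" "\<And>z. z \<noteq> a \<Longrightarrow> z \<notin> R (\<tau> z)" by metis
  define t where "t = Max (range \<tau>)"
  have t: "\<tau> z \<le> t" for z unfolding t_def by (intro Max_ge) auto
  then have "0 \<le> t" using \<tau>(1) order_trans by blast
  moreover have "R t \<subseteq> {a}" using \<tau> anti t by blast
  then have "\<omega> \<in> \<Gamma> t (- t)" using assms(1) by (auto simp: R_def sync_event_def image_subset_iff)
  ultimately show ?thesis by blast
qed

text \<open>A set outside the sigma-algebra has \<open>measure\<close> 0 by convention, so
  probability 1 forces the set to be measurable.\<close>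

lemma AE_of_prob_eq_1:
  assumes "prob {\<omega> \<in> space M. P \<omega>} = 1"
  shows "AE \<omega> in M. P \<omega>"
proof -
  have "{\<omega> \<in> space M. P \<omega>} \<in> sets M" using assms measure_notin_sets by force
  then show ?thesis using assms by (subst (asm) prob_Collect_eq_1) auto
qed

lemma prob_sync_tendsto_1:
  assumes "synchronizes_almost_surely M \<theta> \<phi>"
  shows "((\<lambda>t. prob (\<Gamma> t 0)) \<longlongrightarrow> 1) at_top"
proof -
  have pull: ?thesis if "AE \<omega> in M. \<exists>t\<ge>0. \<omega> \<in> \<Gamma> t (- t)"
  proof -
    have "((\<lambda>t. prob (\<Gamma> t (- t))) \<longlongrightarrow> 1) at_top"
      using that sync_event_pullback_mono sets_sync_event by (intro prob_increasing_tendsto_1) auto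
    moreover have "\<forall>\<^sub>F t in at_top. prob (\<Gamma> t (- t)) = prob (\<Gamma> t 0)"
      using eventually_ge_at_top[of 0] by eventually_elim (rule prob_sync_event)
    ultimately show ?thesis using tendsto_cong by fast
  qed
  consider "sync_in_probability M \<theta> \<phi>" | "sync_forward M \<theta> \<phi>" | "sync_pullback M \<theta> \<phi>"
    | "sync_attractor M \<theta> \<phi>"
    using assms by (auto simp: synchronizes_almost_surely_def)
  then show ?thesis
  proof cases
    case 1
    then have "uniform_limit UNIV (\<lambda>t t0. prob (\<Gamma> t t0)) (\<lambda>_. 1) at_top"
      by (simp add: sync_in_probability_def)
    from tendsto_uniform_limitI[OF this, of 0] show ?thesis by simp
  next
    case 2
    then have "AE \<omega> in M. \<exists>t\<ge>0. is_singleton (range (\<lambda>x. \<phi> t x (\<theta> 0 \<omega>)))"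
      by (intro AE_of_prob_eq_1) (simp add: sync_forward_def)
    then have "AE \<omega> in M. \<exists>t\<ge>0. \<omega> \<in> \<Gamma> t 0"
      using AE_space by eventually_elim (simp add: sync_event_iff_singleton)
    then show ?thesis
      using sync_event_forward_mono sets_sync_event by (intro prob_increasing_tendsto_1) auto
  next
    case 3
    then have "prob {\<omega> \<in> space M. \<exists>t\<ge>0. is_singleton (range (\<lambda>x. \<phi> t x (\<theta> (0 - t) \<omega>)))} = 1"
      unfolding sync_pullback_def by blast
    then have "AE \<omega> in M. \<exists>t\<ge>0. is_singleton (range (\<lambda>x. \<phi> t x (\<theta> (0 - t) \<omega>)))"
      by (rule AE_of_prob_eq_1)
    then have "AE \<omega> in M. \<exists>t\<ge>0. \<omega> \<in> \<Gamma> t (- t)"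
      using AE_space by eventually_elim (simp add: sync_event_iff_singleton)
    then show ?thesis by (rule pull)
  next
    case 4
    then have "AE \<omega> in M. is_singleton (random_attractor \<theta> \<phi> \<omega>)"
      by (simp add: sync_attractor_def)
    then have "AE \<omega> in M. \<exists>t\<ge>0. \<omega> \<in> \<Gamma> t (- t)"
      using AE_space by eventually_elim (rule attractor_singleton_imp_sync)
    then show ?thesis by (rule pull)
  qed
qed

lemma osc_tendsto_0:
  assumes "synchronizes_almost_surely M \<theta> \<phi>"
  shows "(osc \<longlongrightarrow> 0) at_top"
proof (rule tendsto_sandwich[OF _ _ tendsto_const])
  show "((\<lambda>t. 1 - prob (\<Gamma> t 0)) \<longlongrightarrow> 0) at_top"
    using tendsto_diff[OF tendsto_const prob_sync_tendsto_1[OF assms], of 1] by simp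
  show "\<forall>\<^sub>F t in at_top. osc t \<le> 1 - prob (\<Gamma> t 0)"
    using eventually_ge_at_top[of 0] by eventually_elim (rule osc_le_sync)
qed (auto intro: osc_nonneg always_eventually)

section \<open>Jumps in a short time interval\<close>

text \<open>Only the two end times are compared: a path that leaves its state and returns in between
  does not count.\<close>

definition jump_event :: "real \<Rightarrow> real \<Rightarrow> 'w set" where
  "jump_event t \<delta> = {\<omega> \<in> space M. \<exists>x. \<phi> (t + \<delta>) x \<omega> \<noteq> \<phi> t x \<omega>}"

text \<open>Right-continuity in probability can fail at a given time, for instance at time 0 if
  \<open>\<phi> t x = x0\<close> for all \<open>t > 0\<close>; hence the choice of \<open>t\<close>.\<close>

lemma exists_time_small_jump:
  assumes "0 \<le> T"
  obtains t where "T \<le> t" "t \<le> T + 1"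
    "\<And>\<epsilon>. 0 < \<epsilon> \<Longrightarrow> \<exists>\<delta>>0. \<delta> \<le> 1 \<and> prob (jump_event t \<delta>) < \<epsilon>"
proof -
  interpret P: pair_sigma_finite lborel M ..
  define \<delta> where "\<delta> n = 1 / real (Suc n)" for n
  have \<delta>: "0 < \<delta> n" "\<delta> n \<le> 1" for n by (auto simp: \<delta>_def)
  define \<psi> where "\<psi> x = (\<lambda>(t, \<omega>). \<phi> (max 0 t) x \<omega>)" for x
  have \<psi>: "\<psi> x \<in> borel \<Otimes>\<^sub>M M \<rightarrow>\<^sub>M borel" for x
    unfolding \<psi>_def by (rule measurable_phi_pair)
  \<comment> \<open>\<open>Q n\<close> collects the pairs of time and noise with a jump within
    \<open>\<delta> n\<close>. Its slices at fixed time are jump events; its slices at fixed noise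
    are controlled by translation continuity. The union over \<open>z\<close> presents it as a
    finite union of measurable sets.\<close>
  define Q where "Q n = (\<Union>x. \<Union>z. {q \<in> space (borel \<Otimes>\<^sub>M M). fst q \<in> {T..T + 1} \<and>
      \<psi> x q \<in> {z} \<and> \<psi> x (fst q + \<delta> n, snd q) \<in> - {z}})" for n
  have Q_sets: "Q n \<in> sets (lborel \<Otimes>\<^sub>M M)" for n
  proof -
    have "{q \<in> space (borel \<Otimes>\<^sub>M M). fst q \<in> {T..T + 1} \<and> \<psi> x q \<in> {z} \<and>
        \<psi> x (fst q + \<delta> n, snd q) \<in> - {z}} \<in> sets (borel \<Otimes>\<^sub>M M)" for x z
    proof -
      have shift: "(\<lambda>q. (fst q + \<delta> n, snd q)) \<in> borel \<Otimes>\<^sub>M M \<rightarrow>\<^sub>M borel \<Otimes>\<^sub>M M"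
        by (intro measurable_Pair borel_measurable_add measurable_const measurable_fst measurable_snd) simp_all
      let ?S = "space (borel \<Otimes>\<^sub>M M)"
      let ?A1 = "fst -` {T..T + 1} \<inter> ?S"
      let ?A2 = "\<psi> x -` {z} \<inter> ?S"
      let ?A3 = "(\<lambda>q. \<psi> x (fst q + \<delta> n, snd q)) -` (- {z}) \<inter> ?S"
      have "?A1 \<in> sets (borel \<Otimes>\<^sub>M M)"
        by (rule measurable_sets[OF measurable_fst]) simp
      moreover have "?A2 \<in> sets (borel \<Otimes>\<^sub>M M)"
        by (rule measurable_sets[OF \<psi> sets_borel_discrete])
      moreover have "?A3 \<in> sets (borel \<Otimes>\<^sub>M M)"
        by (rule measurable_sets[OF measurable_compose[OF shift \<psi>] sets_borel_discrete])
      ultimately have "?A1 \<inter> (?A2 \<inter> ?A3) \<in> sets (borel \<Otimes>\<^sub>M M)"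
        by (rule sets.Int[OF _ sets.Int])
      also have "?A1 \<inter> (?A2 \<inter> ?A3) = {q \<in> ?S. fst q \<in> {T..T + 1} \<and> \<psi> x q \<in> {z} \<and>
          \<psi> x (fst q + \<delta> n, snd q) \<in> - {z}}"
        by (intro set_eqI) (simp only: vimage_eq Int_iff mem_Collect_eq conj_ac conj_absorb conj_left_absorb)
      finally show ?thesis .
    qed
    then have "Q n \<in> sets (borel \<Otimes>\<^sub>M M)" unfolding Q_def by (intro sets.finite_UN finite)
    then show ?thesis by (simp only: sets_pair_measure_cong[OF sets_lborel refl])
  qed
  have slice_t: "Pair t -` Q n = jump_event t (\<delta> n)" if "t \<in> {T..T + 1}" for t n
  proof -
    have "max 0 t = t" "max 0 (t + \<delta> n) = t + \<delta> n" using that assms \<delta>(1)[of n] by auto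
    with that show ?thesis by (auto simp: Q_def jump_event_def \<psi>_def space_pair_measure)
  qed
  have slice_\<omega>: "(\<lambda>n. emeasure lborel ((\<lambda>t. (t, \<omega>)) -` Q n)) \<longlonglongrightarrow> 0" if "\<omega> \<in> space M" for \<omega>
  proof -
    \<comment> \<open>Cutting the occupation times of \<open>z\<close> to a bounded interval makes
      translation continuity applicable. Times shifted out of the interval are then counted too,
      which only enlarges the upper bound.\<close>
    define A where "A x z = {t \<in> {T..T + 1}. \<psi> x (t, \<omega>) = z}" for x z
    have A: "A x z \<in> sets borel" for x z
    proof -
      have "(\<lambda>t. \<psi> x (t, \<omega>)) -` {z} \<inter> space borel \<in> sets borel"
        by (intro measurable_sets[OF measurable_compose[OF measurable_Pair2'[OF that] \<psi>]] sets_borel_discrete)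
      then have "{T..T + 1} \<inter> (\<lambda>t. \<psi> x (t, \<omega>)) -` {z} \<in> sets borel" by auto
      also have "{T..T + 1} \<inter> (\<lambda>t. \<psi> x (t, \<omega>)) -` {z} = A x z" by (auto simp: A_def)
      finally show ?thesis .
    qed
    have bA: "bounded (A x z)" for x z
      by (rule bounded_subset[of "{T..T + 1}"]) (auto simp: A_def)
    have D: "{t \<in> A x z. t + \<delta> n \<notin> A x z} \<in> sets borel" for x z n
    proof -
      have "(\<lambda>t. t + \<delta> n) -` A x z \<inter> space borel \<in> sets borel"
        by (intro measurable_sets[OF _ A]) auto
      then have "A x z - (\<lambda>t. t + \<delta> n) -` A x z \<in> sets borel" using A by auto
      also have "A x z - (\<lambda>t. t + \<delta> n) -` A x z = {t \<in> A x z. t + \<delta> n \<notin> A x z}" by auto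
      finally show ?thesis .
    qed
    have le: "emeasure lborel ((\<lambda>t. (t, \<omega>)) -` Q n)
        \<le> (\<Sum>x\<in>UNIV. \<Sum>z\<in>UNIV. emeasure lborel {t \<in> A x z. t + \<delta> n \<notin> A x z})" for n
    proof -
      have "(\<lambda>t. (t, \<omega>)) -` Q n \<subseteq> (\<Union>x. \<Union>z. {t \<in> A x z. t + \<delta> n \<notin> A x z})"
        by (auto simp: Q_def A_def)
      then have "emeasure lborel ((\<lambda>t. (t, \<omega>)) -` Q n)
          \<le> emeasure lborel (\<Union>x. \<Union>z. {t \<in> A x z. t + \<delta> n \<notin> A x z})"
        using D by (intro emeasure_mono) (auto intro!: sets.finite_UN)
      also have "\<dots> \<le> (\<Sum>x\<in>UNIV. emeasure lborel (\<Union>z. {t \<in> A x z. t + \<delta> n \<notin> A x z}))"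
        using D by (intro emeasure_subadditive_finite) (auto intro!: sets.finite_UN)
      also have "\<dots> \<le> (\<Sum>x\<in>UNIV. \<Sum>z\<in>UNIV. emeasure lborel {t \<in> A x z. t + \<delta> n \<notin> A x z})"
        using D by (intro sum_mono emeasure_subadditive_finite) auto
      finally show ?thesis .
    qed
    have "(\<lambda>n. \<Sum>x\<in>UNIV. \<Sum>z\<in>UNIV. emeasure lborel {t \<in> A x z. t + \<delta> n \<notin> A x z}) \<longlonglongrightarrow> 0"
      unfolding \<delta>_def by (intro tendsto_null_sum translation_continuous_emeasure A bA)
    then show ?thesis
      by (rule tendsto_sandwich[OF always_eventually[OF allI[OF zero_le]]
            always_eventually[OF allI[OF le]] tendsto_const])
  qed
  \<comment> \<open>The slices lie in an interval of length 1, which gives the dominating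
    constant.\<close>
  have "(\<lambda>n. \<integral>\<^sup>+\<omega>. emeasure lborel ((\<lambda>t. (t, \<omega>)) -` Q n) \<partial>M) \<longlonglongrightarrow> (\<integral>\<^sup>+\<omega>. 0 \<partial>M)"
  proof (rule nn_integral_dominated_convergence[where w = "\<lambda>_. 1"])
    show "(\<lambda>\<omega>. emeasure lborel ((\<lambda>t. (t, \<omega>)) -` Q n)) \<in> borel_measurable M" for n
      by (rule P.measurable_emeasure_Pair2[OF Q_sets])
    have "(\<lambda>t. (t, \<omega>)) -` Q n \<subseteq> {T..T + 1}" for \<omega> n by (auto simp: Q_def)
    then have "emeasure lborel ((\<lambda>t. (t, \<omega>)) -` Q n) \<le> emeasure lborel {T..T + 1}" for \<omega> n
      by (intro emeasure_mono) auto
    then show "AE \<omega> in M. emeasure lborel ((\<lambda>t. (t, \<omega>)) -` Q n) \<le> 1" for n by simp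
    show "AE \<omega> in M. (\<lambda>n. emeasure lborel ((\<lambda>t. (t, \<omega>)) -` Q n)) \<longlonglongrightarrow> 0"
      using slice_\<omega> by auto
  qed (auto simp: emeasure_space_1)
  \<comment> \<open>Fubini exchanges the slices: the time integrals of the jump probabilities tend
    to 0.\<close>
  then have lim: "(\<lambda>n. \<integral>\<^sup>+t. emeasure M (Pair t -` Q n) \<partial>lborel) \<longlonglongrightarrow> 0"
    by (simp add: emeasure_pair_measure_alt[OF Q_sets, symmetric] P.emeasure_pair_measure_alt2[OF Q_sets])
  have meas [measurable]: "(\<lambda>t. emeasure M (Pair t -` Q n)) \<in> borel_measurable lborel" for n
    by (rule measurable_emeasure_Pair[OF Q_sets])
  \<comment> \<open>Convergence of the integrals gives no pointwise limit along the whole sequence.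
    The infimum over \<open>n\<close> lies below every term, so its integral vanishes, and one small
    jump probability for each bound is all that is wanted.\<close>
  have "(\<integral>\<^sup>+t. (INF n. emeasure M (Pair t -` Q n)) \<partial>lborel) \<le> 0"
    by (rule LIMSEQ_le_const[OF lim]) (auto intro!: exI[of _ 0] nn_integral_mono INF_lower)
  then have "AE t in lborel. (INF n. emeasure M (Pair t -` Q n)) = 0"
    by (subst nn_integral_0_iff_AE[symmetric]) auto
  \<comment> \<open>The interval is not a null set, so a property that holds almost everywhere holds
    at some point of it.\<close>
  moreover have "\<not> (AE t in lborel. t \<notin> {T..T + 1})"
  proof
    assume "AE t in lborel. t \<notin> {T..T + 1}"
    then have "emeasure lborel {T..T + 1} = 0"
      by (subst (asm) AE_iff_measurable[of "{T..T + 1}"]) auto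
    then show False by simp
  qed
  ultimately obtain t where t: "t \<in> {T..T + 1}" "(INF n. emeasure M (Pair t -` Q n)) = 0"
    by (blast intro: eventually_mono)
  show ?thesis
  proof (rule that[of t])
    fix \<epsilon> :: real assume "0 < \<epsilon>"
    then have "(INF n. emeasure M (Pair t -` Q n)) < ennreal \<epsilon>" using t(2) by simp
    then obtain n where "emeasure M (jump_event t (\<delta> n)) < ennreal \<epsilon>"
      using slice_t[OF t(1)] by (auto simp: INF_less_iff)
    then have "prob (jump_event t (\<delta> n)) < \<epsilon>"
      by (simp add: emeasure_eq_measure ennreal_less_iff)
    then show "\<exists>\<delta>>0. \<delta> \<le> 1 \<and> prob (jump_event t \<delta>) < \<epsilon>" using \<delta> by blast
  qed (use t in auto)
qed

section \<open>Independence and exponential decay\<close>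

lemma jump_event_sets:
  assumes "0 \<le> t" "0 \<le> \<delta>"
  shows "jump_event t \<delta> \<in> sets M"
proof -
  have "jump_event t \<delta> = (\<Union>x. \<Union>z. {\<omega> \<in> space M. \<phi> (t + \<delta>) x \<omega> \<in> - {z}} \<inter> {\<omega> \<in> space M. \<phi> t x \<omega> \<in> {z}})"
    by (auto simp: jump_event_def)
  also have "\<dots> \<in> sets M"
    using assms by (intro sets.finite_UN sets.Int event_phi) auto
  finally show ?thesis .
qed

text \<open>Outside the jump event the state at time \<open>t + \<delta>\<close> is still the one at
  time \<open>t\<close>. The latter is determined on \<open>[0, t + \<delta>)\<close>, because
  \<delta> is positive, and is therefore independent of the solutions restarted at
  \<open>t + \<delta>\<close>.\<close>

lemma approximate_Chapman_Kolmogorov: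
  assumes ind: "stochastically_independent M \<theta> \<phi>"
    and t: "0 \<le> t" and \<delta>: "0 < \<delta>" and s: "0 \<le> s"
  shows "\<bar>p (t + \<delta> + s) x B - (\<Sum>y\<in>UNIV. p t x {y} * p s y B)\<bar> \<le> prob (jump_event t \<delta>)"
proof -
  define F where "F y = {\<omega> \<in> space M. \<phi> t x \<omega> \<in> {y}}" for y
  define G where "G y = {\<omega> \<in> space M. \<phi> s y (\<theta> (t + \<delta>) \<omega>) \<in> B}" for y
  define E where "E = {\<omega> \<in> space M. \<phi> (t + \<delta> + s) x \<omega> \<in> B}"
  let ?J = "jump_event t \<delta>"
  have sets: "F y \<in> sets M" "G y \<in> sets M" "E \<in> sets M" "?J \<in> sets M" for y
    unfolding F_def G_def E_def using t s \<delta>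
    by (simp_all only: event_phi event_phi_theta jump_event_sets add_nonneg_nonneg less_imp_le)
  have "prob (F y \<inter> G y) = p t x {y} * p s y B" for y
  proof -
    have "F y \<in> solution_events M \<theta> \<phi> 0 (t + \<delta>) x"
      unfolding solution_events_def F_def
      by (intro sigma_sets.Basic CollectI exI[of _ t] exI[of _ "{y}"])
         (use t \<delta> in \<open>auto simp: theta_0 sets_borel_discrete\<close>)
    \<comment> \<open>The added 1 puts the observation time \<open>t + \<delta> + s\<close> inside
      the half-open interval, even for \<open>s = 0\<close>.\<close>
    moreover have "G y \<in> solution_events M \<theta> \<phi> (t + \<delta>) (t + \<delta> + s + 1) y"
      unfolding solution_events_def G_def
      by (intro sigma_sets.Basic CollectI exI[of _ "t + \<delta> + s"] exI[of _ B])
         (use s in \<open>auto simp: sets_borel_discrete\<close>)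
    moreover have "indep_set (solution_events M \<theta> \<phi> 0 (t + \<delta>) x)
        (solution_events M \<theta> \<phi> (t + \<delta>) (t + \<delta> + s + 1) y)"
      using ind t \<delta> unfolding stochastically_independent_def by auto
    ultimately have "prob (F y \<inter> G y) = prob (F y) * prob (G y)" by (intro indep_setD)
    then show ?thesis
      by (simp only: F_def G_def prob_phi_theta[OF s] p_def[of t x, symmetric])
  qed
  moreover have "prob (\<Union>y. F y \<inter> G y) = (\<Sum>y\<in>UNIV. prob (F y \<inter> G y))"
    using sets by (intro finite_measure_finite_Union) (auto simp: disjoint_family_on_def F_def)
  ultimately have H: "prob (\<Union>y. F y \<inter> G y) = (\<Sum>y\<in>UNIV. p t x {y} * p s y B)" by simp
  have Hs: "(\<Union>y. F y \<inter> G y) \<in> sets M" using sets by (intro sets.finite_UN) auto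
  have step: "\<phi> (t + \<delta> + s) x \<omega> = \<phi> s (\<phi> t x \<omega>) (\<theta> (t + \<delta>) \<omega>)" if "\<omega> \<in> space M" "\<omega> \<notin> ?J" for \<omega>
    using phi_cocycle[of s "t + \<delta>" \<omega> x] that t s \<delta> by (auto simp: jump_event_def add.commute)
  have "E \<subseteq> (\<Union>y. F y \<inter> G y) \<union> ?J" "(\<Union>y. F y \<inter> G y) \<subseteq> E \<union> ?J"
    using step by (auto simp: E_def F_def G_def)
  then have "prob E \<le> prob (\<Union>y. F y \<inter> G y) + prob ?J" "prob (\<Union>y. F y \<inter> G y) \<le> prob E + prob ?J"
    using Hs sets by (meson finite_measure_mono measure_Un_le order_trans sets.Un)+
  moreover have "p (t + \<delta> + s) x B = prob E" by (simp add: p_def E_def)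
  ultimately show ?thesis by (simp add: H abs_le_iff)
qed

text \<open>Submultiplicativity of the Dobrushin coefficient. Both rows have total mass 1, so a
  constant may be subtracted from \<open>p s y B\<close>; then only the states where row
  \<open>x\<close> outweighs row \<open>x'\<close> contribute positively.\<close>

lemma sum_difference_le_osc:
  assumes "0 \<le> t"
  shows "(\<Sum>y\<in>UNIV. p t x {y} * p s y B) - (\<Sum>y\<in>UNIV. p t x' {y} * p s y B) \<le> osc t * osc s"
proof -
  \<comment> \<open>Subtracting the minimum moves the values of \<open>p s y B\<close> into the
    range from 0 to \<open>osc s\<close>.\<close>
  define m where "m = (MIN y. p s y B)"
  define S where "S = {y. p t x' {y} \<le> p t x {y}}"
  have m: "0 \<le> p s y B - m" "p s y B - m \<le> osc s" for y
  proof -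
    have "m \<le> p s y B" unfolding m_def by (intro Min_le) auto
    then show "0 \<le> p s y B - m" by simp
    have "m \<in> range (\<lambda>y. p s y B)" unfolding m_def by (intro Min_in) auto
    then show "p s y B - m \<le> osc s" using osc_ge by auto
  qed
  have one: "(\<Sum>y\<in>UNIV. p t x {y}) = 1" for x
    using p_eq_sum_singletons[OF assms, of x UNIV] p_UNIV by simp
  have "(\<Sum>y\<in>UNIV. p t x {y} * p s y B) - (\<Sum>y\<in>UNIV. p t x' {y} * p s y B)
      = (\<Sum>y\<in>UNIV. (p t x {y} - p t x' {y}) * (p s y B - m))"
    by (simp add: algebra_simps sum.distrib sum_subtractf one flip: sum_distrib_left)
  also have "\<dots> \<le> (\<Sum>y\<in>UNIV. if y \<in> S then (p t x {y} - p t x' {y}) * osc s else 0)"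
    using m by (intro sum_mono) (auto simp: S_def intro!: mult_left_mono mult_nonpos_nonneg)
  also have "\<dots> = (p t x S - p t x' S) * osc s"
    by (simp add: p_eq_sum_singletons[OF assms, of _ S] sum_subtractf sum_distrib_right sum.If_cases
        left_diff_distrib)
  also have "\<dots> \<le> osc t * osc s" by (intro mult_right_mono osc_ge osc_nonneg)
  finally show ?thesis .
qed

text \<open>The factor 2 comes from one jump error for each of the two initial states.\<close>

lemma osc_submultiplicative_jump:
  assumes "stochastically_independent M \<theta> \<phi>" "0 \<le> t" "0 < \<delta>" "0 \<le> s"
  shows "osc (t + \<delta> + s) \<le> osc t * osc s + 2 * prob (jump_event t \<delta>)"
proof (rule osc_le)
  fix x y B
  show "p (t + \<delta> + s) x B - p (t + \<delta> + s) y B \<le> osc t * osc s + 2 * prob (jump_event t \<delta>)"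
    using approximate_Chapman_Kolmogorov[OF assms, of x B] approximate_Chapman_Kolmogorov[OF assms, of y B]
      sum_difference_le_osc[OF assms(2), of x s B y]
    by linarith
qed

lemma osc_exponential:
  assumes sync: "synchronizes_almost_surely M \<theta> \<phi>"
    and ind: "stochastically_independent M \<theta> \<phi>"
  obtains c where "c > 0" "\<And>t. 0 \<le> t \<Longrightarrow> osc t \<le> 2 * exp (- c * t)"
proof -
  have "\<forall>\<^sub>F t in at_top. osc t < 1 / 2"
    using osc_tendsto_0[OF sync] by (rule order_tendstoD) simp
  then obtain T0 where T0: "\<And>t. T0 \<le> t \<Longrightarrow> osc t < 1 / 2"
    by (auto simp: eventually_at_top_linorder)
  define T where "T = max 0 T0"
  have T: "0 \<le> T" "\<And>t. T \<le> t \<Longrightarrow> osc t \<le> 1 / 2" using T0 by (auto simp: T_def less_imp_le)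
  obtain \<tau> where \<tau>: "T \<le> \<tau>" "\<tau> \<le> T + 1"
    "\<And>\<epsilon>. 0 < \<epsilon> \<Longrightarrow> \<exists>\<delta>>0. \<delta> \<le> 1 \<and> prob (jump_event \<tau> \<delta>) < \<epsilon>"
    using exists_time_small_jump[OF T(1)] by metis
  \<comment> \<open>As \<open>\<tau> \<le> T + 1\<close> and \<open>\<delta> \<le> 1\<close>, at
    least \<open>s\<close> remains of any time \<open>u \<ge> s + L\<close> after removing \<tau>
    and \<delta>.\<close>
  define L where "L = T + 2"
  have L: "0 < L" using T by (simp add: L_def)
  \<comment> \<open>The bound \<open>r\<close> is required at all times from \<open>s\<close> on
    because the remaining time varies with \<delta>. The time \<tau> is fixed before
    \<open>e\<close>, and only \<delta> depends on \<open>e\<close>, so the jump error disappears in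
    the limit.\<close>
  have halve: "osc u \<le> r / 2" if "0 \<le> s" and r: "\<And>v. s \<le> v \<Longrightarrow> osc v \<le> r" and "s + L \<le> u" for s r u
  proof (rule field_le_epsilon)
    fix e :: real assume "0 < e"
    then obtain \<delta> where \<delta>: "0 < \<delta>" "\<delta> \<le> 1" "prob (jump_event \<tau> \<delta>) < e / 2"
      using \<tau>(3)[of "e / 2"] by auto
    define v where "v = u - \<tau> - \<delta>"
    have v: "s \<le> v" "u = \<tau> + \<delta> + v" using \<delta> \<tau> that(3) by (auto simp: v_def L_def)
    have "osc u \<le> osc \<tau> * osc v + 2 * prob (jump_event \<tau> \<delta>)"
      unfolding v(2) using ind T(1) \<tau>(1) \<delta>(1) v(1) that(1)
      by (intro osc_submultiplicative_jump) auto
    also have "osc \<tau> * osc v \<le> 1 / 2 * r"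
      using T(2)[OF \<tau>(1)] r[OF v(1)] osc_nonneg by (intro mult_mono) auto
    finally show "osc u \<le> r / 2 + e" using \<delta>(3) by simp
  qed
  have pow: "osc u \<le> (1 / 2) ^ k" if "real k * L \<le> u" for k u
    using that
  proof (induction k arbitrary: u)
    case 0
    then show ?case using osc_le_sync[of u] measure_nonneg[of M "\<Gamma> u 0"] by (simp del: measure_nonneg)
  next
    case (Suc k)
    have "osc u \<le> (1 / 2) ^ k / 2"
      using Suc L by (intro halve[of "real k * L"]) (auto simp: algebra_simps)
    then show ?case by simp
  qed
  show ?thesis
  proof (rule that[of "ln 2 / L"])
    show "ln 2 / L > 0" using L by simp
    fix t :: real assume t: "0 \<le> t"
    \<comment> \<open>Rounding \<open>t / L\<close> down costs at most one halving, which is the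
      constant 2 in the bound.\<close>
    define k where "k = nat \<lfloor>t / L\<rfloor>"
    have k: "real k \<le> t / L" "t / L \<le> real k + 1" using t L by (auto simp: k_def)
    have "osc t \<le> (1 / 2) ^ k" using pow k(1) L by (simp add: field_simps)
    also have "\<dots> = exp (- (real k * ln 2))"
      by (simp add: exp_minus exp_of_nat_mult power_one_over inverse_eq_divide)
    also have "\<dots> \<le> exp (ln 2 - ln 2 / L * t)"
    proof -
      have "(t / L) * ln 2 \<le> (real k + 1) * ln 2" using k(2) by (intro mult_right_mono) auto
      then show ?thesis by (simp add: algebra_simps)
    qed
    also have "\<dots> = 2 * exp (- (ln 2 / L) * t)" by (simp add: exp_diff exp_minus field_simps)
    finally show "osc t \<le> 2 * exp (- (ln 2 / L) * t)" .
  qed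
qed

section \<open>Suprema over initial distributions and the theorem\<close>

lemma SUP_tv_dist_evolved:
  assumes "0 \<le> t"
  defines "S \<equiv> SUP (\<mu>, \<nu>)\<in>UNIV. tv_dist (evolved_distribution M \<phi> t \<mu>) (evolved_distribution M \<phi> t \<nu>)"
  shows "0 \<le> S" "S \<le> osc t"
proof -
  let ?f = "\<lambda>(\<mu>, \<nu>). tv_dist (evolved_distribution M \<phi> t \<mu>) (evolved_distribution M \<phi> t \<nu>)"
  have le: "?f q \<le> osc t" for q using tv_dist_evolved_le_osc[OF assms(1)] by (cases q) simp
  then show "S \<le> osc t" unfolding S_def by (intro cSUP_least) auto
  \<comment> \<open>\<open>undefined\<close> stands for an arbitrary pair of distributions. The real
    supremum dominates its value because \<open>osc t\<close> bounds the whole family above.\<close>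
  have "0 \<le> ?f undefined" using tv_dist_nonneg by (simp add: case_prod_beta)
  also have "\<dots> \<le> S" unfolding S_def using le by (intro cSUP_upper bdd_aboveI2) auto
  finally show "0 \<le> S" .
qed

lemma SUP_tv_dist_stationary:
  assumes "0 \<le> t" and "stationary_distribution M \<phi> \<pi>"
  defines "S \<equiv> SUP \<mu>\<in>UNIV. tv_dist (evolved_distribution M \<phi> t \<mu>) \<pi>"
  shows "0 \<le> S" "S \<le> osc t"
proof -
  have "\<pi> = evolved_distribution M \<phi> t \<pi>"
    using assms by (simp add: stationary_distribution_def)
  then have le: "tv_dist (evolved_distribution M \<phi> t \<mu>) \<pi> \<le> osc t" for \<mu>
    using tv_dist_evolved_le_osc[OF assms(1), of \<mu> \<pi>] by simp
  then show "S \<le> osc t" unfolding S_def by (intro cSUP_least) auto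
  have "0 \<le> tv_dist (evolved_distribution M \<phi> t undefined) \<pi>" by (rule tv_dist_nonneg)
  also have "\<dots> \<le> S" unfolding S_def using le by (intro cSUP_upper bdd_aboveI2) auto
  finally show "0 \<le> S" .
qed

end

theorem theorem16:
  fixes M :: "'w measure"
    and \<theta> :: "real \<Rightarrow> 'w \<Rightarrow> 'w"
    and \<phi> :: "real \<Rightarrow> 'x::{finite, discrete_topology} \<Rightarrow> 'w \<Rightarrow> 'x"
  assumes "random_dynamical_system M \<theta> \<phi>"
    and "synchronizes_almost_surely M \<theta> \<phi>"
  shows
    "((\<lambda>t. SUP (\<mu>, \<nu>)\<in>UNIV. tv_dist (evolved_distribution M \<phi> t \<mu>) (evolved_distribution M \<phi> t \<nu>))
        \<longlongrightarrow> 0) at_top \<and>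
     (\<forall>\<pi>. stationary_distribution M \<phi> \<pi> \<longrightarrow>
        ((\<lambda>t. SUP \<mu>\<in>UNIV. tv_dist (evolved_distribution M \<phi> t \<mu>) \<pi>) \<longlongrightarrow> 0) at_top) \<and>
     (stochastically_independent M \<theta> \<phi> \<longrightarrow>
        (\<exists>C>0. \<exists>c>0. \<forall>t\<ge>0.
           (SUP (\<mu>, \<nu>)\<in>UNIV. tv_dist (evolved_distribution M \<phi> t \<mu>) (evolved_distribution M \<phi> t \<nu>))
             \<le> C * exp (- c * t)) \<and>
        (\<forall>\<pi>. stationary_distribution M \<phi> \<pi> \<longrightarrow>
           (\<exists>C>0. \<exists>c>0. \<forall>t\<ge>0.
              (SUP \<mu>\<in>UNIV. tv_dist (evolved_distribution M \<phi> t \<mu>) \<pi>) \<le> C * exp (- c * t))))"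
proof -
  interpret random_dynamical_system M \<theta> \<phi> by fact
  interpret discrete_rds M \<theta> \<phi> ..
  note sync = assms(2)
  have lim: "(f \<longlongrightarrow> 0) at_top" if "\<And>t. 0 \<le> t \<Longrightarrow> 0 \<le> f t" "\<And>t. 0 \<le> t \<Longrightarrow> f t \<le> osc t" for f
    by (intro tendsto_sandwich[OF _ _ tendsto_const osc_tendsto_0[OF sync]]
        eventually_mono[OF eventually_ge_at_top[of 0]] that)
  have rate: "\<exists>C>0. \<exists>c>0. \<forall>t\<ge>0. f t \<le> C * exp (- c * t)"
    if ind: "stochastically_independent M \<theta> \<phi>" and f: "\<And>t. 0 \<le> t \<Longrightarrow> f t \<le> osc t" for f
  proof -
    obtain c where "c > 0" "\<And>t. 0 \<le> t \<Longrightarrow> osc t \<le> 2 * exp (- c * t)"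
      using osc_exponential[OF sync ind] by metis
    with f show ?thesis by (intro exI[of _ 2] exI[of _ c] conjI) (auto intro: order_trans)
  qed
  show ?thesis
    using SUP_tv_dist_evolved SUP_tv_dist_stationary
    by (intro conjI allI impI lim rate) auto
qed

end
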